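(* Every reduced spherical convex body $R\subset S^2$ such that $\Delta(R)\geq\frac{\pi}{2}$ is a spherical body of constant width $\Delta(R)$.
   Context: $S^2$ is the unit sphere in $E^3$ with spherical (geodesic) distance. For non-antipodal $a,b$, the arc $ab$ is the shorter part of the great circle through $a,b$. A set $C\subset S^2$ is convex if it contains no pair of antipodes and $ab\subset C$ for all $a,b\in C$. A convex body is a closed convex set with non-empty interior. A hemisphere is the set of points at distance at most $\frac{\pi}{2}$ from a point (its center). A hemisphere $K$ supports $C$ if $C\subset K$ and $\mathrm{bd}(C)\cap\mathrm{bd}(K)\neq\emptyset$. If hemispheres $G,H$ are different and not opposite (centers not antipodal), $L=G\cap H$ is a lune, bounded by the semicircles $\mathrm{bd}(G)\cap H$ and $\mathrm{bd}(H)\cap G$. Its thickness $\Delta(L)$ is the spherical distance between the centers (midpoints) of these semicircles. For a hemisphere $K$ supporting $C$, $\mathrm{width}_K(C)$ is the minimum of $\Delta(K\cap K')$ over all hemispheres $K'$ supporting $C$ for which $K\cap K'$ is a lune. The thickness $\Delta(C)$ is the minimum of $\mathrm{width}_K(C)$ over all hemispheres $K$ supporting $C$. A convex body $R$ is reduced if $\Delta(Z)<\Delta(R)$ for every convex body $Z\subset R$ with $Z\neq R$. A convex body $C$ is of constant width $w$ if $\mathrm{width}_K(C)=w$ for every hemisphere $K$ supporting $C$. *)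

theory Defs
  imports "HOL-Analysis.Analysis"
begin

abbreviation S2 :: "(real ^ 3) set" where
  "S2 \<equiv> sphere 0 1"

text \<open>Boundary and interior are taken relative to \<open>S2\<close>, not in the ambient space.\<close>

abbreviation sph_bd :: "(real ^ 3) set \<Rightarrow> (real ^ 3) set" where
  "sph_bd C \<equiv> top_of_set S2 frontier_of C"

abbreviation sph_int :: "(real ^ 3) set \<Rightarrow> (real ^ 3) set" where
  "sph_int C \<equiv> top_of_set S2 interior_of C"

definition sph_dist :: "real ^ 3 \<Rightarrow> real ^ 3 \<Rightarrow> real" where
  "sph_dist a b = arccos (a \<bullet> b)"

text \<open>For non-antipodal points of \<open>S2\<close> the chord avoids the centre of the sphere, and its
  central projection is the shorter part of the great circle through the two points
  (the single point \<open>a\<close> if \<open>a = b\<close>).\<close>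

definition sph_arc :: "real ^ 3 \<Rightarrow> real ^ 3 \<Rightarrow> (real ^ 3) set" where
  "sph_arc a b = (\<lambda>x. x /\<^sub>R norm x) ` closed_segment a b"

definition sph_convex :: "(real ^ 3) set \<Rightarrow> bool" where
  "sph_convex C \<longleftrightarrow>
     C \<subseteq> S2 \<and> (\<forall>a\<in>C. - a \<notin> C) \<and> (\<forall>a\<in>C. \<forall>b\<in>C. sph_arc a b \<subseteq> C)"

definition sph_convex_body :: "(real ^ 3) set \<Rightarrow> bool" where
  "sph_convex_body C \<longleftrightarrow> sph_convex C \<and> closed C \<and> sph_int C \<noteq> {}"

definition hemisphere :: "real ^ 3 \<Rightarrow> (real ^ 3) set" where
  "hemisphere c = {x \<in> S2. sph_dist c x \<le> pi / 2}"

definition is_hemisphere :: "(real ^ 3) set \<Rightarrow> bool" where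
  "is_hemisphere K \<longleftrightarrow> (\<exists>c\<in>S2. K = hemisphere c)"

definition supports :: "(real ^ 3) set \<Rightarrow> (real ^ 3) set \<Rightarrow> bool" where
  "supports K C \<longleftrightarrow> is_hemisphere K \<and> C \<subseteq> K \<and> sph_bd C \<inter> sph_bd K \<noteq> {}"

text \<open>A lune is handled through the pair of hemispheres whose intersection it is.\<close>

definition opposite :: "(real ^ 3) set \<Rightarrow> (real ^ 3) set \<Rightarrow> bool" where
  "opposite G H \<longleftrightarrow> (\<exists>c\<in>S2. G = hemisphere c \<and> H = hemisphere (- c))"

definition lune_pair :: "(real ^ 3) set \<Rightarrow> (real ^ 3) set \<Rightarrow> bool" where
  "lune_pair G H \<longleftrightarrow> is_hemisphere G \<and> is_hemisphere H \<and> G \<noteq> H \<and> \<not> opposite G H"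

definition semicircle :: "(real ^ 3) set \<Rightarrow> (real ^ 3) set \<Rightarrow> (real ^ 3) set" where
  "semicircle G H = sph_bd G \<inter> H"

text \<open>The endpoints of \<open>semicircle G H\<close> are the two points of \<open>sph_bd G \<inter> sph_bd H\<close>; its centre
  is the point of it equidistant from them.\<close>

definition semicircle_center :: "(real ^ 3) set \<Rightarrow> (real ^ 3) set \<Rightarrow> real ^ 3" where
  "semicircle_center G H =
     (THE m. m \<in> semicircle G H \<and>
        (\<forall>p \<in> sph_bd G \<inter> sph_bd H. \<forall>q \<in> sph_bd G \<inter> sph_bd H. sph_dist m p = sph_dist m q))"

definition lune_thickness :: "(real ^ 3) set \<Rightarrow> (real ^ 3) set \<Rightarrow> real" where
  "lune_thickness G H = sph_dist (semicircle_center G H) (semicircle_center H G)"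

text \<open>On the reals, \<open>LEAST\<close> denotes the minimum; for a convex body both minima
  below are attained, by compactness.\<close>

definition sph_width :: "(real ^ 3) set \<Rightarrow> (real ^ 3) set \<Rightarrow> real" where
  "sph_width K C = (LEAST d. \<exists>K'. supports K' C \<and> lune_pair K K' \<and> d = lune_thickness K K')"

definition sph_thickness :: "(real ^ 3) set \<Rightarrow> real" where
  "sph_thickness C = (LEAST d. \<exists>K. supports K C \<and> d = sph_width K C)"

definition reduced_body :: "(real ^ 3) set \<Rightarrow> bool" where
  "reduced_body R \<longleftrightarrow> sph_convex_body R \<and>
     (\<forall>Z. sph_convex_body Z \<and> Z \<subset> R \<longrightarrow> sph_thickness Z < sph_thickness R)"

definition constant_width_body :: "(real ^ 3) set \<Rightarrow> real \<Rightarrow> bool" where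
  "constant_width_body C w \<longleftrightarrow>
     sph_convex_body C \<and> (\<forall>K. supports K C \<longrightarrow> sph_width K C = w)"

end

theory Submission
  imports Defs
begin

text \<open>
  A convex body \<open>C\<close> is studied through its polar, the set of centres of the hemispheres that
  contain it; the supporting hemispheres are those whose centre lies on the boundary of the polar.
  A lune with hemisphere centres \<open>c\<close> and \<open>d\<close> has thickness \<open>pi - sph_dist c d\<close>
  (\<open>lune_thickness_hemisphere\<close>), and a point of the polar farthest from a given one is on the
  boundary (\<open>polar_farthest_supp\<close>). Hence the width of \<open>C\<close> at a supporting hemisphere with
  centre \<open>c\<close> is \<open>pi\<close> minus the largest distance from \<open>c\<close> to the polar, and the thickness
  of \<open>C\<close> is \<open>pi\<close> minus the diameter of the polar (\<open>sph_width_polar\<close>,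
  \<open>sph_thickness_polar\<close>). Reducedness of \<open>R\<close> thus says that its polar cannot be enlarged
  without increasing its diameter \<open>\<delta>\<close>, and the hypothesis on the thickness says
  \<open>\<delta> \<le> pi / 2\<close>.

  Suppose a boundary point \<open>c\<close> of the polar of \<open>R\<close> has distance less than \<open>\<delta>\<close> to every
  point of the polar. Some \<open>p\<close> outside the polar, close to \<open>c\<close>, then has distance at most
  \<open>\<delta>\<close> to every point of the polar. Cutting \<open>R\<close> by the hemisphere with centre \<open>p\<close> gives
  a strictly smaller body whose polar is the convex hull of \<open>p\<close> and the polar of \<open>R\<close>
  (\<open>polar_cut\<close>, a form of Farkas' lemma). Because spherical balls of radius at most
  \<open>pi / 2\<close> are convex, forming this hull does not increase the diameter
  (\<open>inner_conic_hull_ge\<close>); so the smaller body is at least as thick as \<open>R\<close>, contradicting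
  reducedness. Hence every width of \<open>R\<close> equals \<open>pi - \<delta>\<close>.

  Distances are handled as inner products throughout: a larger distance is a smaller inner product,
  and distance at most \<open>pi / 2\<close> is a nonnegative inner product.
\<close>

section \<open>Hemispheres and lunes in terms of centres\<close>

lemma unit_inner_bounds:
  fixes a b :: "'a::real_inner"
  assumes "norm a = 1" "norm b = 1"
  shows "\<bar>a \<bullet> b\<bar> \<le> 1"
  using Cauchy_Schwarz_ineq2[of a b] assms by simp

lemma unit_inner_eq_1:
  fixes a b :: "'a::real_inner"
  assumes "norm a = 1" "norm b = 1" "a \<bullet> b = 1"
  shows "a = b"
proof -
  have "(a - b) \<bullet> (a - b) = 0"
    using assms by (simp add: inner_diff inner_commute norm_eq_1)
  then show ?thesis by simp
qed

lemma unit_inner_eq_minus_1: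
  fixes a b :: "'a::real_inner"
  assumes "norm a = 1" "norm b = 1" "a \<bullet> b = -1"
  shows "b = - a"
  using unit_inner_eq_1[of "- a" b] assms by simp

lemma sph_dist_le_iff:
  assumes "a \<in> S2" "b \<in> S2" "c \<in> S2" "d \<in> S2"
  shows "sph_dist a b \<le> sph_dist c d \<longleftrightarrow> c \<bullet> d \<le> a \<bullet> b"
  using assms unfolding sph_dist_def by (intro arccos_le_mono) (auto intro!: unit_inner_bounds)

lemma mem_hemisphere:
  assumes "c \<in> S2"
  shows "x \<in> hemisphere c \<longleftrightarrow> x \<in> S2 \<and> 0 \<le> c \<bullet> x"
proof -
  have "arccos (c \<bullet> x) \<le> pi / 2 \<longleftrightarrow> 0 \<le> c \<bullet> x" if "x \<in> S2"
    using arccos_le_mono[of "c \<bullet> x" 0] unit_inner_bounds[of c x] assms that by simp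
  then show ?thesis by (auto simp: hemisphere_def sph_dist_def)
qed

lemma hemisphere_inject:
  assumes "c \<in> S2" "d \<in> S2" "hemisphere c = hemisphere d"
  shows "c = d"
proof (rule ccontr)
  assume "c \<noteq> d"
  \<comment> \<open>The direction from \<open>d\<close> to \<open>c\<close> lies in the first hemisphere only.\<close>
  define x where "x = (c - d) /\<^sub>R norm (c - d)"
  have nz: "norm (c - d) > 0" using \<open>c \<noteq> d\<close> by simp
  have x: "x \<in> S2" using nz by (simp add: x_def)
  have lt: "c \<bullet> d < 1"
    using unit_inner_eq_1[of c d] unit_inner_bounds[of c d] assms \<open>c \<noteq> d\<close> by fastforce
  have "c \<bullet> (c - d) = 1 - c \<bullet> d" "d \<bullet> (c - d) = c \<bullet> d - 1"
    using assms by (auto simp: inner_diff_right norm_eq_1 inner_commute)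
  then have "0 \<le> c \<bullet> x" "d \<bullet> x < 0"
    using nz lt by (auto simp: x_def mult_pos_neg)
  then have "x \<in> hemisphere c" "x \<notin> hemisphere d"
    using x assms(1,2) by (auto simp: mem_hemisphere)
  then show False using assms(3) by simp
qed

lemma lune_pair_hemisphere_iff:
  assumes "c \<in> S2" "d \<in> S2"
  shows "lune_pair (hemisphere c) (hemisphere d) \<longleftrightarrow> d \<noteq> c \<and> d \<noteq> - c"
proof -
  have "opposite (hemisphere c) (hemisphere d) \<longleftrightarrow> d = - c"
  proof
    assume "opposite (hemisphere c) (hemisphere d)"
    then obtain e where e: "e \<in> S2" "hemisphere c = hemisphere e" "hemisphere d = hemisphere (- e)"
      by (auto simp: opposite_def)
    then have "c = e" "d = - e"
      using assms hemisphere_inject[of c e] hemisphere_inject[of d "- e"] by auto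
    then show "d = - c" by simp
  qed (use assms in \<open>auto simp: opposite_def\<close>)
  then show ?thesis
    using assms hemisphere_inject[of c d] by (auto simp: lune_pair_def is_hemisphere_def)
qed

text \<open>A point of the sphere can be pushed a little along any great circle through it without
  leaving an open set.\<close>

lemma openin_sphere_rotate:
  fixes x y :: "'a::real_inner"
  assumes U: "openin (top_of_set (sphere 0 1)) U" and x: "x \<in> U"
    and y: "norm y = 1" and xy: "x \<bullet> y = 0"
  obtains a where "sin a > 0" "cos a *\<^sub>R x + sin a *\<^sub>R y \<in> U"
proof -
  obtain T where T: "open T" "U = sphere 0 1 \<inter> T"
    using U by (auto simp: openin_open)
  have nx: "norm x = 1" using x T by auto
  have "((\<lambda>a. cos a *\<^sub>R x + sin a *\<^sub>R y) \<longlongrightarrow> cos 0 *\<^sub>R x + sin 0 *\<^sub>R y) (at_right 0)"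
    by (intro tendsto_intros)
  then have "\<forall>\<^sub>F a in at_right 0. cos a *\<^sub>R x + sin a *\<^sub>R y \<in> T"
    using T x by (intro topological_tendstoD) auto
  moreover have "\<forall>\<^sub>F a::real in at_right 0. a \<in> {0<..<pi}"
    by (rule eventually_at_right_real) simp
  ultimately have "\<forall>\<^sub>F a in at_right 0. cos a *\<^sub>R x + sin a *\<^sub>R y \<in> T \<and> a \<in> {0<..<pi}"
    by (rule eventually_conj)
  then obtain a where a: "cos a *\<^sub>R x + sin a *\<^sub>R y \<in> T" "a \<in> {0<..<pi}"
    using eventually_happens[of _ "at_right (0::real)"] by (auto simp: trivial_limit_at_right_real)
  have "norm (cos a *\<^sub>R x + sin a *\<^sub>R y) = 1"
    using nx y xy
    by (simp add: inner_add inner_commute norm_eq_1 sin_cos_squared_add3)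
  then show thesis
    using that[of a] a T by (auto intro: sin_gt_zero)
qed

text \<open>At a point of \<open>C\<close> orthogonal to \<open>c\<close>, a small rotation towards \<open>- c\<close> leaves the
  hemisphere.\<close>

lemma interior_of_hemisphere_pos:
  assumes c: "c \<in> S2" and C: "\<And>x. x \<in> C \<Longrightarrow> 0 \<le> c \<bullet> x" and x: "x \<in> sph_int C"
  shows "0 < c \<bullet> x"
proof (rule ccontr)
  assume "\<not> 0 < c \<bullet> x"
  moreover have sub: "sph_int C \<subseteq> C" by (rule interior_of_subset)
  ultimately have "c \<bullet> x = 0" using C x by force
  then have "x \<bullet> (- c) = 0" by (simp add: inner_commute)
  then obtain a where a: "sin a > 0" "cos a *\<^sub>R x + sin a *\<^sub>R (- c) \<in> sph_int C"
    using openin_sphere_rotate[of "sph_int C" x "- c"] x c by auto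
  have "c \<bullet> (cos a *\<^sub>R x + sin a *\<^sub>R (- c)) = - sin a"
    using \<open>c \<bullet> x = 0\<close> c by (simp add: inner_diff_right norm_eq_1)
  then show False using C sub a by fastforce
qed

lemma sph_bd_hemisphere:
  assumes c: "c \<in> S2"
  shows "sph_bd (hemisphere c) = {x \<in> S2. c \<bullet> x = 0}"
proof -
  have eq: "hemisphere c = S2 \<inter> {x. 0 \<le> c \<bullet> x}"
    using c by (auto simp: mem_hemisphere)
  have "closedin (top_of_set S2) (hemisphere c)"
    unfolding eq by (intro closedin_closed_Int closed_halfspace_ge)
  then have cl: "top_of_set S2 closure_of hemisphere c = hemisphere c"
    by (simp add: closure_of_closedin)
  have "S2 \<inter> {x. 0 < c \<bullet> x} \<subseteq> sph_int (hemisphere c)"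
    unfolding eq
    by (intro interior_of_maximal openin_open_Int open_halfspace_gt) auto
  moreover have "0 < c \<bullet> x" if "x \<in> sph_int (hemisphere c)" for x
    using interior_of_hemisphere_pos[OF c _ that] c by (auto simp: mem_hemisphere)
  ultimately show ?thesis
    unfolding frontier_of_def cl using c by (fastforce simp: mem_hemisphere)
qed

text \<open>The two corners of the lune are the unit vectors along \<open>\<plusminus> cross3 c d\<close>. A point equidistant
  from these antipodes is orthogonal to both, so the centre of the semicircle lies in the plane of
  \<open>c\<close> and \<open>d\<close>; it is the component of \<open>d\<close> orthogonal to \<open>c\<close>, normalized.\<close>

lemma semicircle_center_hemisphere:
  assumes c: "c \<in> S2" and d: "d \<in> S2" and ne: "d \<noteq> c" "d \<noteq> - c"
  defines "s \<equiv> c \<bullet> d"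
  shows "semicircle_center (hemisphere c) (hemisphere d) = (d - s *\<^sub>R c) /\<^sub>R sqrt (1 - s\<^sup>2)"
proof -
  have cc: "c \<bullet> c = 1" and dd: "d \<bullet> d = 1" using c d by (auto simp: norm_eq_1)
  have sd: "c \<bullet> d = s" "d \<bullet> c = s" by (simp_all add: s_def inner_commute)
  have "\<bar>s\<bar> \<le> 1" "s \<noteq> 1" "s \<noteq> -1"
    using c d ne unit_inner_bounds[of c d] unit_inner_eq_1[of c d] unit_inner_eq_minus_1[of c d]
    by (auto simp: s_def)
  then have "s\<^sup>2 < 1" by (simp add: abs_square_less_1)
  define r where "r = sqrt (1 - s\<^sup>2)"
  have r: "r > 0" "r\<^sup>2 = 1 - s\<^sup>2" using \<open>s\<^sup>2 < 1\<close> by (auto simp: r_def)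
  define n where "n = cross3 c d"
  have nc: "n \<bullet> c = 0" "n \<bullet> d = 0" by (auto simp: n_def dot_cross_self)
  have nn: "n \<bullet> n = r\<^sup>2"
    using cc dd sd r(2) by (simp add: n_def dot_cross power2_eq_square)
  then have nz: "norm n > 0" using r(1) by auto
  define p where "p = n /\<^sub>R norm n"
  let ?B = "sph_bd (hemisphere c) \<inter> sph_bd (hemisphere d)"
  have B: "?B = {x \<in> S2. c \<bullet> x = 0 \<and> d \<bullet> x = 0}"
    using c d by (auto simp: sph_bd_hemisphere)
  have p: "p \<in> ?B" "- p \<in> ?B"
    unfolding B using nz nc by (auto simp: p_def inner_commute)
  define m where "m = (d - s *\<^sub>R c) /\<^sub>R r"
  have "c \<bullet> (d - s *\<^sub>R c) = 0" "d \<bullet> (d - s *\<^sub>R c) = r * r"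
    using cc dd sd r(2) by (auto simp: inner_diff_right power2_eq_square)
  then have mc: "c \<bullet> m = 0" and md: "d \<bullet> m = r"
    using r(1) by (auto simp: m_def)
  have "(d - s *\<^sub>R c) \<bullet> m = r" using mc md by (simp add: inner_diff_left)
  moreover have "m \<bullet> m = inverse r * ((d - s *\<^sub>R c) \<bullet> m)" by (simp add: m_def)
  ultimately have "m \<bullet> m = 1" using r(1) by simp
  then have m: "m \<in> S2" by (simp add: norm_eq_1)
  have "semicircle_center (hemisphere c) (hemisphere d) = m"
    unfolding semicircle_center_def
  proof (rule the_equality)
    have "sph_dist m q = pi / 2" if "q \<in> ?B" for q
      using that unfolding B by (simp add: m_def inner_diff_left sph_dist_def)
    moreover have "m \<in> semicircle (hemisphere c) (hemisphere d)"
      using m mc md r(1) c d by (simp add: semicircle_def sph_bd_hemisphere mem_hemisphere)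
    ultimately show "m \<in> semicircle (hemisphere c) (hemisphere d) \<and>
        (\<forall>p\<in>?B. \<forall>q\<in>?B. sph_dist m p = sph_dist m q)"
      by metis
  next
    fix k
    assume k: "k \<in> semicircle (hemisphere c) (hemisphere d) \<and>
        (\<forall>p\<in>?B. \<forall>q\<in>?B. sph_dist k p = sph_dist k q)"
    then have k1: "k \<in> S2" "c \<bullet> k = 0" "0 \<le> d \<bullet> k"
      using c d by (auto simp: semicircle_def sph_bd_hemisphere mem_hemisphere)
    have "sph_dist k p = sph_dist k (- p)" using k p by blast
    then have "arccos (k \<bullet> p) = arccos (- (k \<bullet> p))" by (simp add: sph_dist_def)
    moreover have "\<bar>k \<bullet> p\<bar> \<le> 1" using k1 p B by (intro unit_inner_bounds) auto
    ultimately have "k \<bullet> p = 0" using arccos_eq_iff[of "k \<bullet> p" "- (k \<bullet> p)"] by auto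
    then have kn: "k \<bullet> n = 0" using nz by (simp add: p_def)
    \<comment> \<open>\<open>k\<close> is orthogonal to \<open>n\<close>, so expanding \<open>n \<times> (k \<times> n)\<close> in two ways places it in the
      plane of \<open>c\<close> and \<open>d\<close>.\<close>
    have "cross3 k n = (k \<bullet> d) *\<^sub>R c"
      using k1(2) by (simp add: n_def Lagrange inner_commute)
    moreover have "cross3 n (cross3 k n) = r\<^sup>2 *\<^sub>R k"
      using kn nn by (simp add: Lagrange inner_commute)
    moreover have "cross3 n c = d - s *\<^sub>R c"
    proof -
      have "cross3 n c = - cross3 c n" by (rule cross_skew)
      then show ?thesis using cc sd by (simp add: n_def Lagrange)
    qed
    ultimately have eq: "r\<^sup>2 *\<^sub>R k = (k \<bullet> d) *\<^sub>R (d - s *\<^sub>R c)"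
      by (simp add: cross_mult_right)
    have "r\<^sup>2 * (k \<bullet> k) = (k \<bullet> d) * (k \<bullet> d)"
      using arg_cong[OF eq, of "\<lambda>v. k \<bullet> v"] k1(2) by (simp add: inner_diff_right inner_commute)
    then have "(k \<bullet> d)\<^sup>2 = r\<^sup>2" using k1 by (simp add: norm_eq_1 power2_eq_square)
    then have "k \<bullet> d = r"
      by (rule power2_eq_imp_eq) (use k1(3) r(1) in \<open>simp_all add: inner_commute\<close>)
    then have "r *\<^sub>R (r *\<^sub>R k) = r *\<^sub>R (d - s *\<^sub>R c)"
      using eq by (simp add: power2_eq_square)
    then have "r *\<^sub>R k = d - s *\<^sub>R c"
      by (rule scaleR_left_imp_eq[rotated]) (use r(1) in simp)
    then have "r *\<^sub>R k /\<^sub>R r = m" by (simp only: m_def)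
    then show "k = m" using r(1) by simp
  qed
  then show ?thesis by (simp add: m_def r_def)
qed

text \<open>In the plane of \<open>c\<close> and \<open>d\<close> the two semicircle centres arise from \<open>c\<close> and \<open>d\<close> by
  quarter turns in opposite directions, which replaces the angle by its supplement.\<close>

lemma lune_thickness_hemisphere:
  assumes c: "c \<in> S2" and d: "d \<in> S2" and ne: "d \<noteq> c" "d \<noteq> - c"
  shows "lune_thickness (hemisphere c) (hemisphere d) = pi - sph_dist c d"
proof -
  define s where "s = c \<bullet> d"
  have ip: "c \<bullet> c = 1" "d \<bullet> d = 1" "c \<bullet> d = s" "d \<bullet> c = s"
    using c d by (auto simp: norm_eq_1 s_def inner_commute)
  have s: "\<bar>s\<bar> \<le> 1" "s \<noteq> 1" "s \<noteq> -1"
    using c d ne unit_inner_bounds[of c d] unit_inner_eq_1[of c d] unit_inner_eq_minus_1[of c d]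
    by (auto simp: s_def)
  then have "s\<^sup>2 < 1" by (simp add: abs_square_less_1)
  then have r: "sqrt (1 - s\<^sup>2) * sqrt (1 - s\<^sup>2) = 1 - s\<^sup>2" "1 - s\<^sup>2 \<noteq> 0" by auto
  have "c \<noteq> d" "c \<noteq> - d" using ne by auto
  have "semicircle_center (hemisphere c) (hemisphere d) = (d - s *\<^sub>R c) /\<^sub>R sqrt (1 - s\<^sup>2)"
    unfolding s_def by (rule semicircle_center_hemisphere[OF c d ne])
  moreover have "semicircle_center (hemisphere d) (hemisphere c) = (c - s *\<^sub>R d) /\<^sub>R sqrt (1 - s\<^sup>2)"
    using semicircle_center_hemisphere[OF d c \<open>c \<noteq> d\<close> \<open>c \<noteq> - d\<close>] by (simp only: ip)
  ultimately have "semicircle_center (hemisphere c) (hemisphere d)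
      \<bullet> semicircle_center (hemisphere d) (hemisphere c)
    = ((d - s *\<^sub>R c) /\<^sub>R sqrt (1 - s\<^sup>2)) \<bullet> ((c - s *\<^sub>R d) /\<^sub>R sqrt (1 - s\<^sup>2))"
    by (simp only:)
  also have "\<dots> = ((d - s *\<^sub>R c) \<bullet> (c - s *\<^sub>R d)) / (sqrt (1 - s\<^sup>2) * sqrt (1 - s\<^sup>2))"
    by (simp only: inner_scaleR_left inner_scaleR_right divide_inverse inverse_mult_distrib mult_ac)
  also have "(d - s *\<^sub>R c) \<bullet> (c - s *\<^sub>R d) = - s * (1 - s\<^sup>2)"
    using ip by (simp add: inner_diff_left inner_diff_right algebra_simps power2_eq_square)
  finally have "semicircle_center (hemisphere c) (hemisphere d)
      \<bullet> semicircle_center (hemisphere d) (hemisphere c) = - s"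
    unfolding r(1) using r(2) by simp
  then show ?thesis
    using s by (simp add: lune_thickness_def sph_dist_def arccos_minus_abs flip: s_def)
qed

section \<open>The polar body\<close>

definition sph_polar :: "(real ^ 3) set \<Rightarrow> (real ^ 3) set" where
  "sph_polar C = {c \<in> S2. \<forall>x\<in>C. 0 \<le> c \<bullet> x}"

text \<open>For a convex body these are the boundary points of the polar; this form makes the point of
  contact available directly.\<close>

definition supp_centers :: "(real ^ 3) set \<Rightarrow> (real ^ 3) set" where
  "supp_centers C = {c \<in> sph_polar C. \<exists>x\<in>C. c \<bullet> x = 0}"

lemma supp_centers_polar: "supp_centers C \<subseteq> sph_polar C"
  by (auto simp: supp_centers_def)

lemma sph_polar_S2: "sph_polar C \<subseteq> S2"
  by (auto simp: sph_polar_def)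

lemma compact_sph_polar: "compact (sph_polar C)"
proof -
  have "sph_polar C = S2 \<inter> (\<Inter>x\<in>C. {c. 0 \<le> x \<bullet> c})"
    by (auto simp: sph_polar_def inner_commute)
  moreover have "closed (\<Inter>x\<in>C. {c. 0 \<le> x \<bullet> c})"
    by (intro closed_INT ballI closed_halfspace_ge)
  ultimately show ?thesis by (simp add: compact_Int_closed)
qed

context
  fixes C :: "(real ^ 3) set"
  assumes body: "sph_convex_body C"
begin

lemma body_S2: "C \<subseteq> S2" and body_compact: "compact C"
proof -
  show "C \<subseteq> S2" using body by (auto simp: sph_convex_body_def sph_convex_def)
  then have "bounded C" using bounded_subset[OF bounded_sphere] by blast
  then show "compact C" using body by (simp add: compact_eq_bounded_closed sph_convex_body_def)
qed

lemma body_interior_point: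
  obtains x where "x \<in> sph_int C" "x \<in> C"
    "\<And>c. c \<in> sph_polar C \<Longrightarrow> 0 < c \<bullet> x"
proof -
  obtain x where x: "x \<in> sph_int C" using body by (auto simp: sph_convex_body_def)
  then have "x \<in> C" using interior_of_subset[of "top_of_set S2" C] by blast
  moreover have "0 < c \<bullet> x" if "c \<in> sph_polar C" for c
    using interior_of_hemisphere_pos[of c C x] x that by (auto simp: sph_polar_def)
  ultimately show thesis using that x by blast
qed

lemma supports_iff:
  "supports K C \<longleftrightarrow> (\<exists>c\<in>supp_centers C. K = hemisphere c)"
proof -
  have "closedin (top_of_set S2) C"
    using body body_S2 by (auto simp: sph_convex_body_def closedin_closed_eq)
  then have bd: "sph_bd C = C - sph_int C"
    by (simp add: frontier_of_def closure_of_closedin)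
  have "(C \<subseteq> hemisphere c \<and> sph_bd C \<inter> sph_bd (hemisphere c) \<noteq> {}) \<longleftrightarrow> c \<in> supp_centers C"
    if c: "c \<in> S2" for c
  proof -
    have sub: "C \<subseteq> hemisphere c \<longleftrightarrow> c \<in> sph_polar C"
      using c body_S2 by (auto simp: mem_hemisphere sph_polar_def)
    have "x \<notin> sph_int C" if "c \<in> sph_polar C" "c \<bullet> x = 0" for x
      using interior_of_hemisphere_pos[of c C x] that by (auto simp: sph_polar_def)
    moreover have "norm x = 1" if "x \<in> C" for x using body_S2 that by auto
    ultimately show ?thesis
      unfolding sub bd sph_bd_hemisphere[OF c] supp_centers_def by auto
  qed
  then show ?thesis
    unfolding supports_def is_hemisphere_def using supp_centers_polar sph_polar_S2 by blast
qed

text \<open>A convex set without antipodes is the unit section of a convex cone: along a chord between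
  two of its points the radial projection stays in the set.\<close>

lemma body_open_cone_convex: "convex {l *\<^sub>R x | l x. 0 < l \<and> x \<in> C}"
  unfolding convex_alt
proof safe
  fix u l k :: real and x y
  assume u: "0 \<le> u" "u \<le> 1" and l: "0 < l" "x \<in> C" and k: "0 < k" "y \<in> C"
  define h where "h = (1 - u) * l + u * k"
  have h: "h > 0"
    using u l k unfolding h_def
    by (cases "u = 0") (auto intro!: add_nonneg_pos)
  \<comment> \<open>The combination of \<open>l *\<^sub>R x\<close> and \<open>k *\<^sub>R y\<close>, rescaled to a point of the chord.\<close>
  define z where "z = (1 - u * k / h) *\<^sub>R x + (u * k / h) *\<^sub>R y"
  have w: "1 - u * k / h = (1 - u) * l / h" using h by (simp add: h_def field_simps)
  have "z \<in> closed_segment x y"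
    using u k l h unfolding z_def in_segment
    by (intro exI[of _ "u * k / h"]) (auto simp: divide_le_eq h_def)
  \<comment> \<open>Two unit vectors cancel in a convex combination only with equal weights, that is, only when
    they are antipodes.\<close>
  moreover have "z \<noteq> 0"
  proof
    assume "z = 0"
    then have "(1 - u * k / h) *\<^sub>R x = - ((u * k / h) *\<^sub>R y)"
      by (simp add: z_def eq_neg_iff_add_eq_0)
    then have "norm ((1 - u * k / h) *\<^sub>R x) = norm ((u * k / h) *\<^sub>R y)" by simp
    then have "1 - u * k / h = u * k / h"
      using body_S2 l k u h w by (auto simp: subset_iff)
    then have "(1/2) *\<^sub>R x = - ((1/2) *\<^sub>R y)"
      using \<open>(1 - u * k / h) *\<^sub>R x = - ((u * k / h) *\<^sub>R y)\<close>
      by (metis field_sum_of_halves add_diff_cancel diff_eq_eq mult_2 divide_self_if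
          nonzero_mult_div_cancel_left zero_neq_numeral)
    then have "x = - y" by (metis scaleR_minus_right scaleR_cancel_left zero_neq_one
          divide_eq_0_iff zero_neq_numeral)
    then show False using body l k by (auto simp: sph_convex_body_def sph_convex_def)
  qed
  moreover have "z /\<^sub>R norm z \<in> C"
  proof -
    have "z /\<^sub>R norm z \<in> sph_arc x y"
      using \<open>z \<in> closed_segment x y\<close> unfolding sph_arc_def by (rule imageI)
    moreover have "sph_arc x y \<subseteq> C"
      using body l k by (simp add: sph_convex_body_def sph_convex_def)
    ultimately show ?thesis by blast
  qed
  moreover have "(1 - u) *\<^sub>R l *\<^sub>R x + u *\<^sub>R k *\<^sub>R y = (h * norm z) *\<^sub>R (z /\<^sub>R norm z)"
  proof -
    have "(h * norm z) *\<^sub>R (z /\<^sub>R norm z) = h *\<^sub>R z" using \<open>z \<noteq> 0\<close> by simp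
    also have "\<dots> = (1 - u) *\<^sub>R l *\<^sub>R x + u *\<^sub>R k *\<^sub>R y"
      unfolding z_def w using h by (simp add: scaleR_add_right)
    finally show ?thesis by simp
  qed
  ultimately show "\<exists>l' x'. (1 - u) *\<^sub>R l *\<^sub>R x + u *\<^sub>R k *\<^sub>R y = l' *\<^sub>R x' \<and> 0 < l' \<and> x' \<in> C"
    using h \<open>z \<noteq> 0\<close> by (intro exI[of _ "h * norm z"] exI[of _ "z /\<^sub>R norm z"]) auto
qed

lemma body_convex_hull: "convex hull C \<subseteq> {l *\<^sub>R x | l x. 0 < l \<and> x \<in> C}"
proof (rule hull_minimal)
  have "x = 1 *\<^sub>R x" for x :: "real ^ 3" by simp
  then show "C \<subseteq> {l *\<^sub>R x | l x. 0 < l \<and> x \<in> C}" by fastforce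
qed (rule body_open_cone_convex)

lemma body_hull_nonzero: "0 \<notin> convex hull C"
proof
  assume "0 \<in> convex hull C"
  then obtain l x where "0 = l *\<^sub>R x" "0 < l" "x \<in> C" using body_convex_hull by blast
  then show False using body_S2 by auto
qed

text \<open>The normal of a plane that separates the convex hull of \<open>C\<close> from the origin. This is an
  interior point of the polar, so the polar has more than one point and the width is a minimum over
  a nonempty set of lunes.\<close>

lemma sph_polar_strict_point:
  obtains d where "d \<in> S2" "\<And>x. x \<in> C \<Longrightarrow> 0 < d \<bullet> x"
proof -
  have "closed (convex hull C)"
    by (intro compact_imp_closed compact_convex_hull body_compact)
  then obtain a b where ab: "a \<bullet> 0 < b" "\<forall>x\<in>convex hull C. a \<bullet> x > b"
    using separating_hyperplane_closed_point[of "convex hull C" 0] body_hull_nonzero by blast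
  have pos: "0 < a \<bullet> x" if "x \<in> C" for x
    using ab hull_inc[OF that, of convex] by force
  obtain x0 where "x0 \<in> C" using body_interior_point by blast
  then have "a \<noteq> 0" using pos by force
  then show thesis using that[of "a /\<^sub>R norm a"] pos by simp
qed

text \<open>A point of the polar that lies farthest from a given one is on its boundary. Otherwise
  all unit vectors near \<open>d\<close> belong to the polar, and \<open>d\<close> can be moved further away from
  \<open>c\<close>: directly away if \<open>d \<noteq> c\<close>, in any orthogonal direction if \<open>d = c\<close>. The antipode
  \<open>d = - c\<close>, which is the one interior local maximum of the distance, is never in the polar.\<close>

lemma polar_farthest_supp:
  assumes c: "c \<in> sph_polar C" and d: "d \<in> sph_polar C"
    and min: "\<And>e. e \<in> sph_polar C \<Longrightarrow> c \<bullet> d \<le> c \<bullet> e"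
  shows "d \<in> supp_centers C"
proof (rule ccontr)
  assume "d \<notin> supp_centers C"
  then have pos: "0 < d \<bullet> x" if "x \<in> C" for x
    using d that by (force simp: supp_centers_def sph_polar_def)
  obtain x0 where x0: "x0 \<in> C" "0 < c \<bullet> x0" "0 < d \<bullet> x0"
    using body_interior_point c d by metis
  have nc: "norm c = 1" and nd: "norm d = 1" using c d by (auto simp: sph_polar_def)
  have "continuous_on C (\<lambda>x. d \<bullet> x)" by (intro continuous_intros)
  then obtain x1 where x1: "x1 \<in> C" "\<And>x. x \<in> C \<Longrightarrow> d \<bullet> x1 \<le> d \<bullet> x"
    using continuous_attains_inf[OF body_compact, of "\<lambda>x. d \<bullet> x"] x0 by blast
  \<comment> \<open>Half the minimum of the inner product of \<open>d\<close> with \<open>C\<close>, so that a perturbation of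
    length \<open>\<eta>\<close> keeps all these inner products positive.\<close>
  define \<eta> where "\<eta> = d \<bullet> x1 / 2"
  have \<eta>: "\<eta> > 0" using pos[OF x1(1)] by (simp add: \<eta>_def)
  \<comment> \<open>Minimality of \<open>d\<close> against the normalized perturbed vector, with the norm multiplied out.\<close>
  have move: "c \<bullet> d * norm (d + \<eta> *\<^sub>R v) \<le> c \<bullet> (d + \<eta> *\<^sub>R v)" if v: "norm v = 1" for v
  proof -
    have wpos: "0 < (d + \<eta> *\<^sub>R v) \<bullet> x" if "x \<in> C" for x
    proof -
      have "\<bar>v \<bullet> x\<bar> \<le> 1" using v that body_S2 by (intro unit_inner_bounds) auto
      then have "\<eta> * \<bar>v \<bullet> x\<bar> \<le> \<eta> * 1" using \<eta> by (intro mult_left_mono) auto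
      then have "- \<eta> \<le> \<eta> * (v \<bullet> x)" using \<eta> by (simp add: abs_le_iff abs_mult_pos')
      moreover have "2 * \<eta> \<le> d \<bullet> x" using x1(2)[OF that] by (simp add: \<eta>_def)
      ultimately show ?thesis using \<eta> by (simp add: inner_add_left)
    qed
    then have nz: "norm (d + \<eta> *\<^sub>R v) > 0" using x0(1) by force
    then have "(d + \<eta> *\<^sub>R v) /\<^sub>R norm (d + \<eta> *\<^sub>R v) \<in> sph_polar C"
      using wpos by (auto simp: sph_polar_def intro!: mult_nonneg_nonneg less_imp_le)
    from min[OF this] have "c \<bullet> d \<le> (c \<bullet> (d + \<eta> *\<^sub>R v)) / norm (d + \<eta> *\<^sub>R v)"
      by (simp only: inner_scaleR_right divide_inverse mult.commute)
    then show ?thesis using nz by (simp only: pos_le_divide_eq)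
  qed
  consider "c \<bullet> d = 1" | "c \<bullet> d = -1" | "\<bar>c \<bullet> d\<bar> < 1"
    using unit_inner_bounds[OF nc nd] by linarith
  then show False
  proof cases
    case 1
    then have "c = d" using unit_inner_eq_1 nc nd by blast
    obtain y where y: "y \<noteq> 0" "orthogonal d y"
      using orthogonal_to_vector_exists[of d] by auto
    define v where "v = y /\<^sub>R norm y"
    have v: "norm v = 1" "d \<bullet> v = 0" using y by (auto simp: v_def orthogonal_def)
    have "norm (d + \<eta> *\<^sub>R v) \<le> 1"
      using move[OF v(1)] \<open>c = d\<close> 1 v by (simp add: inner_add_right)
    then have "(norm (d + \<eta> *\<^sub>R v))\<^sup>2 \<le> 1" by (simp add: power_le_one)
    moreover have "(norm (d + \<eta> *\<^sub>R v))\<^sup>2 = 1 + \<eta>\<^sup>2"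
      unfolding power2_norm_eq_inner
      using v nd by (simp add: inner_add inner_commute norm_eq_1 power2_eq_square)
    ultimately show False using \<eta> by simp
  next
    case 2
    then have "d = - c" using unit_inner_eq_minus_1 nc nd by blast
    then show False using x0 by simp
  next
    case 3
    let ?w = "d + \<eta> *\<^sub>R (- c)"
    have mv: "c \<bullet> d * norm ?w \<le> c \<bullet> d - \<eta>"
      using move[of "- c"] nc by (simp add: inner_diff_right norm_eq_1)
    show False
    proof (cases "c \<bullet> d \<ge> 0")
      case True
      have "1 - \<eta> * (c \<bullet> d) = d \<bullet> ?w"
        using nd by (simp add: inner_diff_right norm_eq_1 inner_commute)
      also have "\<dots> \<le> norm ?w" using norm_cauchy_schwarz[of d ?w] nd by simp
      finally have "c \<bullet> d * (1 - \<eta> * (c \<bullet> d)) \<le> c \<bullet> d - \<eta>"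
        using mv mult_left_mono[OF _ True] by (meson order_trans)
      then have "\<eta> * 1 \<le> \<eta> * (c \<bullet> d)\<^sup>2" by (simp add: algebra_simps power2_eq_square)
      then have "1 \<le> (c \<bullet> d)\<^sup>2" using \<eta> by simp
      moreover have "(c \<bullet> d)\<^sup>2 < 1" using 3 by (simp add: abs_square_less_1)
      ultimately show False by simp
    next
      case False
      have "norm ?w \<le> 1 + \<eta>" using norm_triangle_ineq[of d "\<eta> *\<^sub>R (- c)"] nc nd \<eta> by simp
      then have "c \<bullet> d * (1 + \<eta>) \<le> c \<bullet> d * norm ?w"
        using False by (intro mult_left_mono_neg) auto
      then have "c \<bullet> d * \<eta> \<le> - 1 * \<eta>" using mv by (simp add: algebra_simps)
      then have "c \<bullet> d \<le> -1" using \<eta> by (simp only: mult_le_cancel_right)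
      then show False using 3 by simp
    qed
  qed
qed

section \<open>Width and thickness as distances in the polar\<close>

lemma sph_width_polar:
  assumes c: "c \<in> supp_centers C"
  obtains d where "d \<in> supp_centers C" "sph_width (hemisphere c) C = pi - sph_dist c d"
    "\<forall>e\<in>sph_polar C. c \<bullet> d \<le> c \<bullet> e"
proof -
  have cp: "c \<in> sph_polar C" using c supp_centers_polar by blast
  have "continuous_on (sph_polar C) (\<lambda>d. c \<bullet> d)" by (intro continuous_intros)
  then obtain d where d: "d \<in> sph_polar C" "\<And>e. e \<in> sph_polar C \<Longrightarrow> c \<bullet> d \<le> c \<bullet> e"
    using continuous_attains_inf[OF compact_sph_polar, of C "\<lambda>d. c \<bullet> d"] cp by blast
  then have ds: "d \<in> supp_centers C" using polar_farthest_supp cp by blast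
  have S: "c \<in> S2" "d \<in> S2" using cp d sph_polar_S2 by blast+
  have noneg: "e \<noteq> - c" if "e \<in> sph_polar C" for e
    using body_interior_point cp that by (metis inner_minus_left neg_0_less_iff_less not_less_iff_gr_or_eq)
  \<comment> \<open>Otherwise the polar would be the single point \<open>c\<close>.\<close>
  have "d \<noteq> c"
  proof
    assume "d = c"
    obtain f where f: "f \<in> S2" "\<And>x. x \<in> C \<Longrightarrow> 0 < f \<bullet> x" using sph_polar_strict_point by blast
    then have "f \<in> sph_polar C" by (auto simp: sph_polar_def intro: less_imp_le)
    then have "1 \<le> c \<bullet> f" using d(2) \<open>d = c\<close> S by (simp add: norm_eq_1)
    moreover have "c \<bullet> f \<le> 1" using unit_inner_bounds[of c f] S f by simp
    ultimately have "c = f" using unit_inner_eq_1[of c f] S f by simp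
    then show False using c f(2) by (force simp: supp_centers_def)
  qed
  have "sph_width (hemisphere c) C = pi - sph_dist c d"
    unfolding sph_width_def
  proof (rule Least_equality)
    show "\<exists>K'. supports K' C \<and> lune_pair (hemisphere c) K' \<and>
        pi - sph_dist c d = lune_thickness (hemisphere c) K'"
      using ds \<open>d \<noteq> c\<close> noneg[OF d(1)] S
      by (intro exI[of _ "hemisphere d"])
        (auto simp: supports_iff lune_pair_hemisphere_iff lune_thickness_hemisphere)
  next
    fix y
    assume "\<exists>K'. supports K' C \<and> lune_pair (hemisphere c) K' \<and>
        y = lune_thickness (hemisphere c) K'"
    then obtain e where e: "e \<in> supp_centers C" "lune_pair (hemisphere c) (hemisphere e)"
        "y = lune_thickness (hemisphere c) (hemisphere e)"
      by (auto simp: supports_iff)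
    then have ep: "e \<in> sph_polar C" "e \<in> S2" using supp_centers_polar sph_polar_S2 by blast+
    then have "y = pi - sph_dist c e"
      using e S by (simp add: lune_pair_hemisphere_iff lune_thickness_hemisphere)
    then show "pi - sph_dist c d \<le> y"
      using d(2)[OF ep(1)] sph_dist_le_iff[of c e c d] S ep by simp
  qed
  then show thesis using that ds d(2) by blast
qed

text \<open>Each point of a pair realizing the diameter of the polar is farthest from the other, hence on
  the boundary, so the pair also realizes the smallest width.\<close>

lemma sph_thickness_polar:
  obtains c d where "c \<in> sph_polar C" "d \<in> sph_polar C"
    "sph_thickness C = pi - sph_dist c d"
    "\<forall>e\<in>sph_polar C. \<forall>f\<in>sph_polar C. c \<bullet> d \<le> e \<bullet> f"
proof -
  let ?P = "sph_polar C"
  obtain g where "g \<in> S2" "\<And>x. x \<in> C \<Longrightarrow> 0 < g \<bullet> x" using sph_polar_strict_point by blast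
  then have "g \<in> ?P" by (auto simp: sph_polar_def intro: less_imp_le)
  then have "?P \<times> ?P \<noteq> {}" by blast
  moreover have "compact (?P \<times> ?P)" by (intro compact_Times compact_sph_polar)
  moreover have "continuous_on (?P \<times> ?P) (\<lambda>z. fst z \<bullet> snd z)" by (intro continuous_intros)
  ultimately obtain z where z: "z \<in> ?P \<times> ?P" "\<forall>y\<in>?P \<times> ?P. fst z \<bullet> snd z \<le> fst y \<bullet> snd y"
    using continuous_attains_inf[of "?P \<times> ?P" "\<lambda>z. fst z \<bullet> snd z"] by blast
  then obtain c d where cd: "c \<in> ?P" "d \<in> ?P"
      and min: "\<And>e f. e \<in> ?P \<Longrightarrow> f \<in> ?P \<Longrightarrow> c \<bullet> d \<le> e \<bullet> f"
    by fastforce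
  have cs: "c \<in> supp_centers C"
    using polar_farthest_supp[of d c] cd min by (metis inner_commute)
  have S: "c \<in> S2" "d \<in> S2" using cd sph_polar_S2 by blast+
  have "sph_thickness C = pi - sph_dist c d"
    unfolding sph_thickness_def
  proof (rule Least_equality)
    obtain d' where d': "d' \<in> supp_centers C" "sph_width (hemisphere c) C = pi - sph_dist c d'"
        "\<forall>e\<in>?P. c \<bullet> d' \<le> c \<bullet> e"
      by (rule sph_width_polar[OF cs])
    then have "d' \<in> ?P" using supp_centers_polar by blast
    then have "c \<bullet> d' = c \<bullet> d" using bspec[OF d'(3) cd(2)] min[OF cd(1), of d'] by simp
    then have "pi - sph_dist c d = sph_width (hemisphere c) C"
      using d'(2) by (simp add: sph_dist_def)
    then show "\<exists>K. supports K C \<and> pi - sph_dist c d = sph_width K C"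
      using cs by (auto simp: supports_iff)
  next
    fix y
    assume "\<exists>K. supports K C \<and> y = sph_width K C"
    then obtain e where e: "e \<in> supp_centers C" "y = sph_width (hemisphere e) C"
      by (auto simp: supports_iff)
    obtain f where f: "f \<in> supp_centers C" "y = pi - sph_dist e f"
      using sph_width_polar[OF e(1)] e(2) by metis
    have ef: "e \<in> ?P" "f \<in> ?P" "e \<in> S2" "f \<in> S2"
      using e f supp_centers_polar sph_polar_S2 by blast+
    show "pi - sph_dist c d \<le> y"
      using f(2) min[OF ef(1,2)] sph_dist_le_iff[of e f c d] S ef by simp
  qed
  with cd show thesis by (rule that) (use min in blast)
qed

end

section \<open>Cutting a body by a hemisphere\<close>

text \<open>A hyperplane separating a point from a closed convex cone can be taken through the apex.\<close>

lemma separate_from_cone: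
  fixes S :: "'a::euclidean_space set"
  assumes S: "compact S" "S \<noteq> {}" "0 \<notin> convex hull S" and q: "q \<notin> conic hull (convex hull S)"
  obtains a where "a \<bullet> q < 0" "\<And>x. x \<in> S \<Longrightarrow> 0 \<le> a \<bullet> x"
proof -
  let ?Q = "conic hull (convex hull S)"
  have "closed ?Q" using S by (intro closed_conic_hull) (auto intro: compact_convex_hull)
  moreover have "convex ?Q" by (intro convex_conic_hull convex_convex_hull)
  ultimately obtain a b where ab: "a \<bullet> q < b" "\<forall>x\<in>?Q. a \<bullet> x > b"
    using separating_hyperplane_closed_point[of ?Q q] q by blast
  have cone: "l *\<^sub>R x \<in> ?Q" if "x \<in> S" "0 \<le> l" for l x
    using that hull_inc[of x S convex] by (auto simp: conic_hull_explicit)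
  obtain x0 where "x0 \<in> S" using S by blast
  then have "0 \<in> ?Q" using cone[of x0 0] by simp
  then have "b < 0" using bspec[OF ab(2), of 0] by simp
  moreover have "0 \<le> a \<bullet> x" if "x \<in> S" for x
  proof (rule ccontr)
    assume "\<not> 0 \<le> a \<bullet> x"
    then have neg: "a \<bullet> x < 0" by simp
    then have "0 \<le> b / (a \<bullet> x)" using \<open>b < 0\<close> by (simp add: divide_nonpos_neg)
    then have "b < a \<bullet> ((b / (a \<bullet> x)) *\<^sub>R x)" using bspec[OF ab(2) cone[OF that]] by blast
    moreover have "a \<bullet> ((b / (a \<bullet> x)) *\<^sub>R x) = b" using neg by simp
    ultimately show False by simp
  qed
  ultimately show thesis using that ab(1) by force
qed

text \<open>A point outside \<open>C\<close> is outside the cone over \<open>C\<close>, and the normal of a hyperplane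
  separating it from that cone, normalized, is a point of the polar that detects it.\<close>

lemma bipolar:
  assumes C: "sph_convex_body C" and a: "a \<in> S2" and pos: "\<And>d. d \<in> sph_polar C \<Longrightarrow> 0 \<le> a \<bullet> d"
  shows "a \<in> C"
proof (rule ccontr)
  assume "a \<notin> C"
  have ne: "C \<noteq> {}" using body_interior_point[OF C] by blast
  have "a \<notin> conic hull (convex hull C)"
  proof
    assume "a \<in> conic hull (convex hull C)"
    then obtain k y where ky: "a = k *\<^sub>R y" "0 \<le> k" "y \<in> convex hull C"
      by (auto simp: conic_hull_explicit)
    then obtain l x where lx: "y = l *\<^sub>R x" "0 < l" "x \<in> C"
      using body_convex_hull[OF C] by blast
    have "norm a = k * l * norm x" using ky lx by (simp add: abs_mult)
    then have "k * l = 1" using a lx(3) body_S2[OF C] by auto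
    then show False using ky lx \<open>a \<notin> C\<close> by simp
  qed
  then obtain b where b: "b \<bullet> a < 0" "\<And>x. x \<in> C \<Longrightarrow> 0 \<le> b \<bullet> x"
    using separate_from_cone[OF body_compact[OF C] ne body_hull_nonzero[OF C]] by blast
  then have "b \<noteq> 0" by auto
  then have "b /\<^sub>R norm b \<in> sph_polar C" using b by (auto simp: sph_polar_def)
  then have "0 \<le> a \<bullet> b" using pos[of "b /\<^sub>R norm b"] \<open>b \<noteq> 0\<close>
    by (simp add: zero_le_mult_iff)
  then show False using b by (simp add: inner_commute)
qed

lemma sph_convex_body_cut:
  assumes C: "sph_convex_body C" and p: "p \<in> S2" and x: "x \<in> sph_int C" "0 < p \<bullet> x"
  shows "sph_convex_body (C \<inter> hemisphere p)"
  unfolding sph_convex_body_def sph_convex_def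
proof (intro conjI ballI)
  show "C \<inter> hemisphere p \<subseteq> S2" using body_S2[OF C] by blast
  show "- a \<notin> C \<inter> hemisphere p" if "a \<in> C \<inter> hemisphere p" for a
    using that C by (auto simp: sph_convex_body_def sph_convex_def)
  show "sph_arc a b \<subseteq> C \<inter> hemisphere p"
    if a: "a \<in> C \<inter> hemisphere p" and b: "b \<in> C \<inter> hemisphere p" for a b
  proof -
    have sub: "sph_arc a b \<subseteq> C" using a b C by (auto simp: sph_convex_body_def sph_convex_def)
    have "closed_segment a b \<subseteq> {z. 0 \<le> p \<bullet> z}"
      using a b p by (intro closed_segment_subset convex_halfspace_ge) (auto simp: mem_hemisphere)
    then have "0 \<le> p \<bullet> z" if "z \<in> sph_arc a b" for z
      using that by (auto simp: sph_arc_def)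
    then show ?thesis using sub body_S2[OF C] p by (auto simp: mem_hemisphere)
  qed
  have eq: "C \<inter> hemisphere p = C \<inter> {x. 0 \<le> p \<bullet> x}"
    using body_S2[OF C] p by (auto simp: mem_hemisphere)
  show "closed (C \<inter> hemisphere p)"
    unfolding eq using C
    by (auto simp: sph_convex_body_def intro!: closed_Int closed_halfspace_ge)
  have "openin (top_of_set S2) (sph_int C \<inter> (S2 \<inter> {x. 0 < p \<bullet> x}))"
    by (intro openin_Int openin_interior_of openin_open_Int open_halfspace_gt)
  then have "sph_int C \<inter> (S2 \<inter> {x. 0 < p \<bullet> x}) \<subseteq> sph_int (C \<inter> hemisphere p)"
    unfolding eq using interior_of_subset[of "top_of_set S2" C]
    by (intro interior_of_maximal) auto
  moreover have "x \<in> S2" using x interior_of_subset[of "top_of_set S2" C] body_S2[OF C] by blast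
  ultimately show "sph_int (C \<inter> hemisphere p) \<noteq> {}" using x by blast
qed

text \<open>This is Farkas' lemma: if \<open>q\<close> were outside the cone, the normal \<open>a\<close> of a separating
  hyperplane would lie, up to scaling, in \<open>C\<close> by \<open>bipolar\<close> and in the hemisphere of \<open>p\<close>,
  where \<open>q\<close> is nonnegative. The interior point \<open>x\<close> keeps the origin out of the hull, which
  makes the cone closed.\<close>

lemma polar_cut:
  assumes C: "sph_convex_body C" and p: "p \<in> S2" and x: "x \<in> sph_int C" "0 < p \<bullet> x"
    and q: "q \<in> sph_polar (C \<inter> hemisphere p)"
  shows "q \<in> conic hull (convex hull (insert p (sph_polar C)))"
proof (rule ccontr)
  assume nq: "q \<notin> conic hull (convex hull (insert p (sph_polar C)))"
  have "0 < x \<bullet> y" if "y \<in> insert p (sph_polar C)" for y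
    using that x interior_of_hemisphere_pos[of y C x]
    by (auto simp: sph_polar_def inner_commute)
  then have "convex hull (insert p (sph_polar C)) \<subseteq> {y. 0 < x \<bullet> y}"
    by (intro hull_minimal convex_halfspace_gt) auto
  then have "0 \<notin> convex hull (insert p (sph_polar C))" by auto
  then obtain a where a: "a \<bullet> q < 0" "\<And>y. y \<in> insert p (sph_polar C) \<Longrightarrow> 0 \<le> a \<bullet> y"
    using separate_from_cone[of "insert p (sph_polar C)" q] nq compact_sph_polar
    by (metis compact_insert insert_not_empty)
  then have nz: "a \<noteq> 0" by auto
  let ?a = "a /\<^sub>R norm a"
  have S: "?a \<in> S2" using nz by simp
  have "?a \<in> C" using a nz by (intro bipolar[OF C S]) auto
  moreover have "?a \<in> hemisphere p"
    unfolding mem_hemisphere[OF p] using S a(2)[of p] by (auto simp: inner_commute)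
  ultimately have "0 \<le> q \<bullet> ?a" using q unfolding sph_polar_def by blast
  then show False using a(1) nz by (simp add: inner_commute zero_le_mult_iff)
qed

text \<open>Taking the spherical convex hull does not increase a diameter of at most \<open>pi / 2\<close>. The
  lower bound \<open>t\<close> on inner products passes to the linear convex hull, one argument at a time;
  points of that hull have norm at most 1, so normalizing multiplies by a factor of at least 1,
  which preserves the bound because \<open>t\<close> is nonnegative.\<close>

lemma inner_conic_hull_ge:
  fixes S :: "'a::real_inner set"
  assumes S: "\<And>x. x \<in> S \<Longrightarrow> norm x = 1" and t: "0 \<le> t"
    and ge: "\<And>x y. x \<in> S \<Longrightarrow> y \<in> S \<Longrightarrow> t \<le> x \<bullet> y"
    and u: "u \<in> conic hull (convex hull S)" "norm u = 1"
    and v: "v \<in> conic hull (convex hull S)" "norm v = 1"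
  shows "t \<le> u \<bullet> v"
proof -
  have scale: "\<exists>k z. w = k *\<^sub>R z \<and> 1 \<le> k \<and> z \<in> convex hull S"
    if w: "w \<in> conic hull (convex hull S)" "norm w = 1" for w
  proof -
    obtain k z where kz: "w = k *\<^sub>R z" "0 \<le> k" "z \<in> convex hull S"
      using w by (auto simp: conic_hull_explicit)
    have "convex hull S \<subseteq> cball 0 1" using S by (intro hull_minimal) auto
    then have "norm z \<le> 1" using kz by auto
    then have "k * norm z \<le> k * 1" using kz by (intro mult_left_mono) auto
    then have "1 \<le> k" using kz w by simp
    then show ?thesis using kz by blast
  qed
  have one: "convex hull S \<subseteq> {y. t \<le> x \<bullet> y}" if "x \<in> S" for x
    using that ge by (intro hull_minimal convex_halfspace_ge) auto
  have "convex hull S \<subseteq> {x. t \<le> y \<bullet> x}" if "y \<in> convex hull S" for y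
    using one that by (intro hull_minimal convex_halfspace_ge) (auto simp: inner_commute)
  moreover obtain k z where kz: "u = k *\<^sub>R z" "1 \<le> k" "z \<in> convex hull S"
    using scale[OF u] by blast
  moreover obtain l w where lw: "v = l *\<^sub>R w" "1 \<le> l" "w \<in> convex hull S"
    using scale[OF v] by blast
  ultimately have zw: "t \<le> z \<bullet> w" by (auto simp: inner_commute)
  have "1 * 1 \<le> k * l" using kz lw by (intro mult_mono) auto
  then have "1 * t \<le> (k * l) * (z \<bullet> w)" using zw t by (intro mult_mono) auto
  then show ?thesis using kz lw by (simp add: mult_ac)
qed

section \<open>Reduced bodies of large thickness\<close>

theorem theorem2p4:
  fixes R :: "(real ^ 3) set"
  assumes "reduced_body R"
    and "sph_thickness R \<ge> pi / 2"
  shows "constant_width_body R (sph_thickness R)"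
proof -
  let ?D = "sph_polar R"
  have R: "sph_convex_body R"
    and red: "\<And>Z. sph_convex_body Z \<Longrightarrow> Z \<subset> R \<Longrightarrow> sph_thickness Z < sph_thickness R"
    using assms(1) by (auto simp: reduced_body_def)
  obtain e f where ef: "e \<in> ?D" "f \<in> ?D" and th: "sph_thickness R = pi - sph_dist e f"
    and diam: "\<forall>g\<in>?D. \<forall>h\<in>?D. e \<bullet> f \<le> g \<bullet> h"
    by (rule sph_thickness_polar[OF R])
  have efS: "e \<in> S2" "f \<in> S2" using ef sph_polar_S2 by blast+
  define t where "t = e \<bullet> f"
  have "f \<in> hemisphere e" using th assms(2) efS by (simp add: hemisphere_def)
  then have t: "0 \<le> t" using efS by (simp add: mem_hemisphere t_def)
  have "sph_width K R = sph_thickness R" if "supports K R" for K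
  proof -
    obtain c where c: "c \<in> supp_centers R" "K = hemisphere c"
      using \<open>supports K R\<close> unfolding supports_iff[OF R] by (rule bexE)
    obtain d where d: "d \<in> supp_centers R" and wd: "sph_width K R = pi - sph_dist c d"
      and far: "\<forall>g\<in>?D. c \<bullet> d \<le> c \<bullet> g"
      unfolding c(2) by (rule sph_width_polar[OF R c(1)])
    have cd: "c \<in> ?D" "d \<in> ?D" "c \<in> S2" using c d supp_centers_polar sph_polar_S2 by blast+
    have "\<not> t < c \<bullet> d"
    proof
      assume gap: "t < c \<bullet> d"
      obtain x0 where x0: "x0 \<in> sph_int R" "\<And>c. c \<in> ?D \<Longrightarrow> 0 < c \<bullet> x0"
        using body_interior_point[OF R] by blast
      obtain x where x: "x \<in> R" "c \<bullet> x = 0" using c by (auto simp: supp_centers_def)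
      have xS: "norm x = 1" using x body_S2[OF R] by auto
      \<comment> \<open>Points of \<open>U\<close> have inner product at least \<open>t\<close> with the whole polar, and their
        hemispheres contain \<open>x0\<close> in the interior. Rotating \<open>c\<close> slightly away from the
        contact point \<open>x\<close> stays in \<open>U\<close> but cuts off \<open>x\<close>.\<close>
      define U where "U = S2 \<inter> (ball c (c \<bullet> d - t) \<inter> {y. 0 < x0 \<bullet> y})"
      have "openin (top_of_set S2) U"
        unfolding U_def by (intro openin_open_Int open_Int open_ball open_halfspace_gt)
      moreover have "c \<in> U" using cd gap x0(2)[OF cd(1)] by (simp add: U_def inner_commute)
      moreover have "norm (- x) = 1" "c \<bullet> (- x) = 0" using xS x by auto
      ultimately obtain a where a: "sin a > 0" "cos a *\<^sub>R c + sin a *\<^sub>R (- x) \<in> U"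
        by (rule openin_sphere_rotate)
      define p where "p = cos a *\<^sub>R c + sin a *\<^sub>R (- x)"
      have "p \<in> U" using a(2) by (simp only: p_def)
      then have p: "p \<in> S2" "dist c p < c \<bullet> d - t" "0 < p \<bullet> x0"
        by (auto simp: U_def inner_commute)
      have px: "p \<bullet> x < 0"
        using x xS a(1) by (simp add: p_def inner_diff_left norm_eq_1)
      have pD: "t \<le> p \<bullet> g" if "g \<in> ?D" for g
      proof -
        have "norm g = 1" using that by (simp add: sph_polar_def)
        then have "(c - p) \<bullet> g \<le> dist c p"
          using norm_cauchy_schwarz[of "c - p" g] by (simp add: dist_norm)
        then show ?thesis using bspec[OF far that] p(2) by (simp add: inner_diff_left)
      qed
      let ?S = "insert p ?D"
      have "p \<bullet> p = 1" using p by (simp add: norm_eq_1)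
      moreover have "t \<le> 1" using unit_inner_bounds[of e f] efS by (simp add: t_def)
      ultimately have SS: "t \<le> g \<bullet> h" if "g \<in> ?S" "h \<in> ?S" for g h
        using that pD diam by (auto simp: t_def inner_commute)
      define Z where "Z = R \<inter> hemisphere p"
      have Z: "sph_convex_body Z" unfolding Z_def using R p x0 by (intro sph_convex_body_cut) auto
      have "x \<notin> hemisphere p" using px p by (simp add: mem_hemisphere)
      then have "Z \<subset> R" using x by (auto simp: Z_def)
      then have lt: "sph_thickness Z < sph_thickness R" using red Z by blast
      obtain u v where uv: "u \<in> sph_polar Z" "v \<in> sph_polar Z" "sph_thickness Z = pi - sph_dist u v"
        using sph_thickness_polar[OF Z] by metis
      have uvS: "u \<in> S2" "v \<in> S2" using uv sph_polar_S2 by blast+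
      have hull: "w \<in> conic hull (convex hull ?S)" if "w \<in> sph_polar Z" for w
        using polar_cut[OF R p(1) x0(1) p(3)] that by (simp only: Z_def)
      have unit: "norm g = 1" if "g \<in> ?S" for g
        using that p(1) by (auto simp: sph_polar_def)
      have "t \<le> u \<bullet> v"
        using uvS by (intro inner_conic_hull_ge[OF unit t SS hull[OF uv(1)] _ hull[OF uv(2)]]) simp_all
      then have "sph_dist u v \<le> sph_dist e f"
        using sph_dist_le_iff uvS efS by (simp add: t_def)
      then show False using lt uv(3) th by simp
    qed
    then have "c \<bullet> d = e \<bullet> f" using bspec[OF bspec[OF diam cd(1)] cd(2)] by (simp add: t_def)
    then show ?thesis using wd th by (simp add: sph_dist_def)
  qed
  then show ?thesis using R by (simp add: constant_width_body_def)
qed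

end
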